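(* Let $d\ge 2$ be an integer, let $\mathcal{I}=[-\tfrac12,\tfrac12]$ and let $\mathcal{B}'$ be the family of all boxes contained in $\mathcal{I}^{d}$ having at least $d-1$ sides of equal length. For every $\epsilon>0$ one can construct a (deterministic) $\epsilon$-net $\mathcal{N}_\epsilon$ in the range space $(\mathcal{I}^{d},\mathcal{B}')$ with cardinality $\#\mathcal{N}_\epsilon=O\left(\epsilon^{-1}\cdot\ln(\epsilon^{-1})\right)$ (as $\epsilon\to0^{+}$). Equivalently, one can construct a (deterministic) optical forest in $\mathbb{R}^{d}$ with growth rate $O\left(T^{d}\cdot\ln(T)\right)$ (as $T\to+\infty$).
   Context: A range space is a pair $(\mathcal{S},\mathcal{R})$ where $\mathcal{S}$ is a set and $\mathcal{R}$ is a family of subsets of $\mathcal{S}$ (ranges). A box is a (closed) rectangular parallelepiped in $\mathbb{R}^d$, of arbitrary orientation (the image of a product of $d$ closed intervals under an isometry of $\mathbb{R}^d$). Given $\epsilon>0$, a subset $\mathcal{N}_\epsilon\subseteq\mathcal{I}^{d}$ is an $\epsilon$-net in $(\mathcal{I}^d,\mathcal{R})$ if $\mathcal{N}_\epsilon\cap R\ne\emptyset$ for every $R\in\mathcal{R}$ with $\mu_d(R)\ge\epsilon$, where $\mu_d$ is Lebesgue measure on $\mathcal{I}^d$. The cardinality bound means that there are constants $C>0$, $\epsilon_0\in(0,1)$, depending only on $d$, with $\#\mathcal{N}_\epsilon\le C\epsilon^{-1}\ln(\epsilon^{-1})$ for all $\epsilon\in(0,\epsilon_0]$. A set $\mathfrak{F}\subseteq\mathbb{R}^{d}$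 has growth rate $O(g(T))$ if $\#(B_2(0,T)\cap\mathfrak{F})=O(g(T))$, where $B_2(0,T)$ is the Euclidean ball of radius $T$ about the origin. It is an optical forest with growth rate $O(g(T))$ (where $g(T)\gg T^d$) if it has this growth rate and if there is a constant $C>0$ such that for every $\epsilon\in(0,1)$ and every line segment $L\subseteq\mathbb{R}^d$ of length $C\epsilon^{-(d-1)}$ there is $x\in\mathfrak{F}$ with Euclidean distance $\mathrm{dist}(x,L)\le\epsilon$. "Deterministic" means specified without any random choice. The theorem asserts that both objects exist. *)

theory Defs
  imports "HOL-Analysis.Analysis" "HOL-Library.Landau_Symbols"
begin

definition unit_cube :: "(real ^ 'n::finite) set" where
  "unit_cube = cbox (\<chi> i. - 1 / 2) (\<chi> i. 1 / 2)"

definition euclidean_isometry :: "(real ^ 'n::finite \<Rightarrow> real ^ 'n) \<Rightarrow> bool" where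
  "euclidean_isometry f \<longleftrightarrow> bij f \<and> (\<forall>x y. dist (f x) (f y) = dist x y)"

definition box_with_sides :: "real ^ 'n::finite \<Rightarrow> (real ^ 'n) set \<Rightarrow> bool" where
  "box_with_sides s B \<longleftrightarrow>
     (\<exists>f a b. euclidean_isometry f \<and> (\<forall>i. a $ i \<le> b $ i) \<and> s = b - a \<and> B = f ` cbox a b)"

definition unit_cube_boxes :: "(real ^ 'n::finite) set set" where
  "unit_cube_boxes =
     {B. B \<subseteq> unit_cube \<and>
         (\<exists>s. box_with_sides s B \<and> (\<exists>l. card {i. s $ i = l} \<ge> CARD('n) - 1))}"

definition eps_net ::
  "real \<Rightarrow> (real ^ 'n::finite) set \<Rightarrow> (real ^ 'n) set set \<Rightarrow> (real ^ 'n) set \<Rightarrow> bool" where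
  "eps_net \<epsilon> S \<R> N \<longleftrightarrow>
     N \<subseteq> S \<and> (\<forall>R\<in>\<R>. measure lebesgue R \<ge> \<epsilon> \<longrightarrow> N \<inter> R \<noteq> {})"

(* The explicit finiteness is needed because card of an infinite set is 0. *)
definition has_growth_rate :: "(real ^ 'n::finite) set \<Rightarrow> (real \<Rightarrow> real) \<Rightarrow> bool" where
  "has_growth_rate F g \<longleftrightarrow>
     (\<forall>T. finite (cball 0 T \<inter> F)) \<and> (\<lambda>T. real (card (cball 0 T \<inter> F))) \<in> O[at_top](g)"

(* The first conjunct is the standing requirement that g(T) is at least of order T^d. *)
definition optical_forest :: "(real ^ 'n::finite) set \<Rightarrow> (real \<Rightarrow> real) \<Rightarrow> bool" where
  "optical_forest F g \<longleftrightarrow>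
     (\<lambda>T. T ^ CARD('n)) \<in> O[at_top](g) \<and> has_growth_rate F g \<and>
     (\<exists>C>0. \<forall>\<epsilon>\<in>{0<..<1}. \<forall>p q.
        dist p q = C / \<epsilon> ^ (CARD('n) - 1) \<longrightarrow>
        (\<exists>x\<in>F. infdist x (closed_segment p q) \<le> \<epsilon>))"

end

theory Submission
  imports Defs
begin

text \<open>A box of volume at least \<open>\<epsilon>\<close> in the unit cube has all sides of order at least \<open>\<epsilon>\<close>, so rounding
  its corners to a mesh of order \<open>\<epsilon>\<close> sorts these boxes into polynomially many classes, and all boxes of a
  class share a set of volume comparable to \<open>\<epsilon>\<close>. By averaging, some point of the cube lies in an
  \<open>\<epsilon>\<close>-proportion of any finite family of such sets; choosing points greedily therefore hits \<open>K\<close> sets with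
  \<open>O(\<epsilon>\<^sup>-\<^sup>1 ln K)\<close> points. For the forest, nets for
  the volumes \<open>1 / 2 ^ (d (k + 1))\<close> are scaled by \<open>2 ^ (k + 1)\<close> and restricted to dyadic shells: the
  \<open>\<epsilon>\<close>-neighbourhood of the outer part of a segment contains a box that scales into one of these cubes with
  sufficient volume.\<close>

section \<open>Isometries and Lebesgue measure\<close>

text \<open>A distance-preserving map that fixes the origin is linear; subtracting
  \<open>f 0\<close> reaches that case.\<close>

lemma euclidean_isometry_orthogonal:
  assumes "euclidean_isometry f"
  shows "orthogonal_transformation (\<lambda>x. f x - f 0)"
  using assms unfolding orthogonal_transformation_isometry euclidean_isometry_def
  by (simp add: dist_norm)

lemma orthogonal_euclidean_isometry:
  assumes "orthogonal_transformation Q"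
  shows "euclidean_isometry (\<lambda>x. c + Q x)"
proof -
  have "bij ((+) c \<circ> Q)"
    using orthogonal_transformation_inj[OF assms] orthogonal_transformation_surj[OF assms]
    by (intro bij_comp) (auto simp: bij_def)
  then show ?thesis
    using assms unfolding euclidean_isometry_def orthogonal_transformation_isometry
    by (simp add: comp_def)
qed

lemma euclidean_isometry_image_cball:
  assumes "euclidean_isometry f"
  shows "f ` cball x r = cball (f x) r"
proof -
  have "surj f" and d: "dist (f x) (f y) = dist x y" for x y
    using assms by (auto simp: euclidean_isometry_def bij_def)
  show ?thesis
  proof (intro subset_antisym subsetI)
    fix y assume "y \<in> cball (f x) r"
    moreover obtain z where "y = f z" using \<open>surj f\<close> by (rule surjE)
    ultimately show "y \<in> f ` cball x r" using d by simp
  qed (use d in auto)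
qed

lemma negligible_euclidean_isometry_image:
  assumes f: "euclidean_isometry f" and S: "negligible S"
  shows "negligible (f ` S)"
  using f by (intro negligible_locally_Lipschitz_image[OF _ S])
    (auto simp: euclidean_isometry_def dist_norm[symmetric] intro!: exI[where x = UNIV] exI[where x = "1::real"])

text \<open>The library has invariance of Lebesgue measure under orthogonal maps only for well-ordered
  index types; a Vitali cover by balls, which isometries permute, avoids the restriction.\<close>
lemma emeasure_euclidean_isometry_open:
  fixes f :: "real ^ 'n::finite \<Rightarrow> real ^ 'n"
  assumes f: "euclidean_isometry f" and S: "open S"
  shows "emeasure lebesgue (f ` S) = emeasure lebesgue S"
proof -
  define K where "K = {(x, r). 0 < r \<and> cball x r \<subseteq> S}"
  have "0 < snd i" if "i \<in> K" for i using that by (auto simp: K_def)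
  moreover have "\<exists>i. i \<in> K \<and> x \<in> cball (fst i) (snd i) \<and> snd i < d" if "x \<in> S" "0 < d" for x d
  proof -
    obtain e where "e > 0" "cball x e \<subseteq> S" using \<open>x \<in> S\<close> S by (auto simp: open_contains_cball)
    with \<open>0 < d\<close> show ?thesis
      by (intro exI[of _ "(x, min e (d/2))"]) (auto simp: K_def subset_iff)
  qed
  ultimately obtain C where C: "countable C" "C \<subseteq> K"
    and dj: "pairwise (\<lambda>i j. disjnt (cball (fst i) (snd i)) (cball (fst j) (snd j))) C"
    and neg: "negligible (S - (\<Union>i\<in>C. cball (fst i) (snd i)))"
    by (rule Vitali_covering_theorem_cballs[of K snd S fst])
  define B where "B i = cball (fst i) (snd i)" for i :: "(real ^ 'n) \<times> real"
  have fB: "f ` B i = cball (f (fst i)) (snd i)" for i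
    using f by (simp add: B_def euclidean_isometry_image_cball)
  have inj: "inj f" using f by (simp add: euclidean_isometry_def bij_def)
  have BS: "B i \<subseteq> S" if "i \<in> C" for i using C(2) that unfolding K_def B_def by force
  have disj: "disjoint_family_on B C"
    using dj unfolding pairwise_def disjoint_family_on_def disjnt_def B_def by blast
  have disj': "disjoint_family_on (\<lambda>i. f ` B i) C"
    using disj unfolding disjoint_family_on_def
    by (simp add: image_Int[OF inj, symmetric])
  \<comment> \<open>Balls go to balls of equal radius, and injectivity keeps the images disjoint, so
    countable additivity applies on both sides.\<close>
  have eq: "emeasure lebesgue (\<Union>i\<in>C. f ` B i) = emeasure lebesgue (\<Union>i\<in>C. B i)"
  proof -
    have "emeasure lebesgue (f ` B i) = emeasure lebesgue (B i)" if "i \<in> C" for i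
    proof -
      have "0 < snd i" using that C by (auto simp: K_def)
      then show ?thesis unfolding fB unfolding B_def by (simp add: emeasure_cball)
    qed
    moreover have "f ` B i \<in> sets lebesgue" "B i \<in> sets lebesgue" for i
      unfolding fB by (auto simp: B_def)
    ultimately show ?thesis
      using C(1) disj disj'
      by (simp add: emeasure_UN_countable) (auto intro!: nn_integral_cong)
  qed
  have nul: "S - (\<Union>i\<in>C. B i) \<in> null_sets lebesgue"
    using neg by (simp add: negligible_iff_null_sets B_def)
  have nul': "f ` (S - (\<Union>i\<in>C. B i)) \<in> null_sets lebesgue"
    using negligible_euclidean_isometry_image[OF f neg] by (simp add: negligible_iff_null_sets B_def)
  have sets: "(\<Union>i\<in>C. B i) \<in> sets lebesgue" "(\<Union>i\<in>C. f ` B i) \<in> sets lebesgue"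
    unfolding fB using C(1) by (auto intro!: sets.countable_UN' simp: B_def)
  have S_eq: "S = (\<Union>i\<in>C. B i) \<union> (S - (\<Union>i\<in>C. B i))" using BS by blast
  have fS_eq: "f ` S = (\<Union>i\<in>C. f ` B i) \<union> f ` (S - (\<Union>i\<in>C. B i))"
    using arg_cong[OF S_eq, of "image f"] by (simp only: image_Un image_UN)
  have "emeasure lebesgue (f ` S) = emeasure lebesgue (\<Union>i\<in>C. f ` B i)"
    by (subst fS_eq, rule emeasure_Un_null_set[OF sets(2) nul'])
  also have "\<dots> = emeasure lebesgue S"
    unfolding eq by (subst S_eq, rule emeasure_Un_null_set[OF sets(1) nul, symmetric])
  finally show ?thesis .
qed

text \<open>The closed box is compared with its interior, an open set; the difference is null, and
  so is its image.\<close>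

lemma
  fixes f :: "real ^ 'n::finite \<Rightarrow> real ^ 'n"
  assumes f: "euclidean_isometry f"
  shows lmeasurable_euclidean_isometry_cbox: "f ` cbox a b \<in> lmeasurable"
    and measure_euclidean_isometry_cbox:
      "measure lebesgue (f ` cbox a b) = measure lebesgue (cbox a b)"
proof -
  have "continuous_on UNIV f"
    using f unfolding continuous_on_iff euclidean_isometry_def by metis
  then have "compact (f ` cbox a b)"
    by (meson compact_cbox compact_continuous_image continuous_on_subset subset_UNIV)
  then show "f ` cbox a b \<in> lmeasurable" by (rule lmeasurable_compact)
  have nul: "cbox a b - box a b \<in> null_sets lebesgue"
    using negligible_frontier_interval[of a b] by (simp add: negligible_iff_null_sets)
  then have nul': "f ` (cbox a b - box a b) \<in> null_sets lebesgue"
    using negligible_euclidean_isometry_image[OF f] by (simp add: negligible_iff_null_sets)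
  have eq: "cbox a b = box a b \<union> (cbox a b - box a b)" using box_subset_cbox[of a b] by blast
  have inj: "inj f" using f by (simp add: euclidean_isometry_def bij_def)
  have "f ` box a b = f ` cbox a b - f ` (cbox a b - box a b)"
    using inj box_subset_cbox[of a b] by (auto dest: injD)
  moreover have "f ` cbox a b \<in> sets lebesgue" using \<open>f ` cbox a b \<in> lmeasurable\<close> by auto
  ultimately have s: "f ` box a b \<in> sets lebesgue" using nul' by auto
  have "emeasure lebesgue (f ` cbox a b) = emeasure lebesgue (f ` box a b)"
    by (subst eq, subst image_Un, rule emeasure_Un_null_set[OF s nul'])
  also have "\<dots> = emeasure lebesgue (box a b)"
    by (rule emeasure_euclidean_isometry_open[OF f open_box])
  also have "\<dots> = emeasure lebesgue (cbox a b)"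
    by (subst eq, rule emeasure_Un_null_set[symmetric, OF _ nul]) auto
  finally show "measure lebesgue (f ` cbox a b) = measure lebesgue (cbox a b)"
    by (simp add: measure_def)
qed

section \<open>Hitting many large sets with few points\<close>

text \<open>Averaging: the number of members of \<open>\<A>\<close> through a point has integral at
  least \<open>\<delta> * card \<A>\<close> and vanishes outside \<open>U\<close>. As
  \<open>U\<close> has measure at most 1, its maximum is no smaller than the integral.\<close>

lemma exists_popular_point:
  assumes fin: "finite \<A>" and U: "U \<in> lmeasurable" "measure lebesgue U \<le> 1" "U \<noteq> {}"
    and A: "\<And>A. A \<in> \<A> \<Longrightarrow> A \<in> sets lebesgue \<and> A \<subseteq> U \<and> \<delta> \<le> measure lebesgue A"
  shows "\<exists>x\<in>U. \<delta> * real (card \<A>) \<le> real (card {A \<in> \<A>. x \<in> A})"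
proof -
  define c where "c x = card {A \<in> \<A>. x \<in> A}" for x
  have "c x \<le> card \<A>" for x unfolding c_def using fin by (intro card_mono) auto
  \<comment> \<open>The count is a natural number bounded by \<open>card \<A>\<close>, so its
    maximum over \<open>U\<close> is attained.\<close>
  then have "finite (c ` U)" by (meson atMost_iff finite_atMost finite_subset image_subsetI)
  then have "Max (c ` U) \<in> c ` U" using U(3) by (intro Max_in) auto
  then obtain x where x: "x \<in> U" "Max (c ` U) = c x" by blast
  have mx: "c y \<le> c x" if "y \<in> U" for y
    using \<open>finite (c ` U)\<close> that x(2) Max_ge[of "c ` U" "c y"] by auto
  have mA: "A \<in> lmeasurable" if "A \<in> \<A>" for A
    using A[OF that] U(1) fmeasurableI2 by blast
  have int: "integrable lebesgue (indicat_real A)" if "A \<in> \<A>" for A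
    using mA[OF that] by (auto simp: fmeasurable_def)
  have sumc: "(\<Sum>A\<in>\<A>. indicat_real A y) = real (c y)" for y
    unfolding c_def using fin by (simp add: indicator_def sum.If_cases Int_def)
  have "\<delta> * real (card \<A>) \<le> (\<Sum>A\<in>\<A>. measure lebesgue A)"
    using sum_bounded_below[of \<A> \<delta> "measure lebesgue"] A by (simp add: mult.commute)
  also have "\<dots> = (\<integral>y. (\<Sum>A\<in>\<A>. indicat_real A y) \<partial>lebesgue)"
    using int by (simp add: Bochner_Integration.integral_sum)
  also have "\<dots> \<le> (\<integral>y. real (c x) * indicat_real U y \<partial>lebesgue)"
  proof (rule integral_mono)
    show "integrable lebesgue (\<lambda>y. real (c x) * indicat_real U y)"
      using U(1) by (auto simp: fmeasurable_def)
    fix y show "(\<Sum>A\<in>\<A>. indicat_real A y) \<le> real (c x) * indicat_real U y"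
    proof (cases "y \<in> U")
      case True
      then show ?thesis unfolding sumc using mx by simp
    next
      case False
      then have "y \<notin> A" if "A \<in> \<A>" for A using A that by blast
      then show ?thesis by (auto simp: indicator_def intro!: sum_nonpos)
    qed
  qed (use int in auto)
  also have "\<dots> \<le> real (c x)"
    using U by (simp add: mult_left_le)
  finally show ?thesis using x(1) unfolding c_def by blast
qed

text \<open>A popular point hits a \<delta>-share of the sets still missed, so each round multiplies
  their number by at most \<open>1 - \<delta>\<close>. The induction varies the family because the
  later rounds see only the missed sets.\<close>

lemma greedy_hitting_set:
  assumes "finite \<A>" and U: "U \<in> lmeasurable" "measure lebesgue U \<le> 1" "U \<noteq> {}"
    and "\<And>A. A \<in> \<A> \<Longrightarrow> A \<in> sets lebesgue \<and> A \<subseteq> U \<and> \<delta> \<le> measure lebesgue A"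
    and "\<delta> \<le> 1"
  shows "\<exists>N\<subseteq>U. finite N \<and> card N \<le> m \<and>
           real (card {A \<in> \<A>. A \<inter> N = {}}) \<le> (1 - \<delta>) ^ m * real (card \<A>)"
  using assms(1,5)
proof (induction m arbitrary: \<A>)
  case 0
  then show ?case by (intro exI[of _ "{}"]) auto
next
  case (Suc m)
  obtain x where x: "x \<in> U" "\<delta> * real (card \<A>) \<le> real (card {A \<in> \<A>. x \<in> A})"
    using exists_popular_point[OF Suc.prems(1) U Suc.prems(2)] by blast
  define \<B> where "\<B> = {A \<in> \<A>. x \<notin> A}"
  have "card \<A> = card {A \<in> \<A>. x \<in> A} + card \<B>"
    unfolding \<B>_def using Suc.prems(1)
    by (subst card_Un_disjoint[symmetric]) (auto intro: arg_cong[where f = card])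
  with x(2) have cB: "real (card \<B>) \<le> (1 - \<delta>) * real (card \<A>)" by (simp add: algebra_simps)
  obtain N where N: "N \<subseteq> U" "finite N" "card N \<le> m"
    "real (card {A \<in> \<B>. A \<inter> N = {}}) \<le> (1 - \<delta>) ^ m * real (card \<B>)"
    using Suc.IH[of \<B>] Suc.prems unfolding \<B>_def by force
  have "{A \<in> \<A>. A \<inter> insert x N = {}} = {A \<in> \<B>. A \<inter> N = {}}" unfolding \<B>_def by auto
  then have "real (card {A \<in> \<A>. A \<inter> insert x N = {}}) \<le> (1 - \<delta>) ^ m * real (card \<B>)"
    using N(4) by simp
  also have "\<dots> \<le> (1 - \<delta>) ^ m * ((1 - \<delta>) * real (card \<A>))"
    using cB \<open>\<delta> \<le> 1\<close> by (intro mult_left_mono) auto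
  finally show ?case
    using N(1-3) x(1) card_insert_le_m1[of "Suc m" N x]
    by (intro exI[of _ "insert x N"]) (auto simp: mult_ac)
qed

text \<open>After \<open>m \<ge> (ln K + 1) / \<delta>\<close> rounds at most
  \<open>(1 - \<delta>) ^ m * K \<le> exp (- \<delta> * m) * K < 1\<close> sets are missed, hence
  none. The 1 next to \<open>ln K\<close> makes the bound strict; the outer 1 pays for rounding
  \<open>m\<close> up.\<close>

lemma hitting_set_bound:
  assumes fin: "finite \<A>" and U: "U \<in> lmeasurable" "measure lebesgue U \<le> 1" "U \<noteq> {}"
    and A: "\<And>A. A \<in> \<A> \<Longrightarrow> A \<in> sets lebesgue \<and> A \<subseteq> U \<and> \<delta> \<le> measure lebesgue A"
    and \<delta>: "0 < \<delta>" and K: "real (card \<A>) \<le> K" "1 \<le> K"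
  shows "\<exists>N\<subseteq>U. finite N \<and> real (card N) \<le> (ln K + 1) / \<delta> + 1 \<and> (\<forall>A\<in>\<A>. A \<inter> N \<noteq> {})"
proof (cases "\<A> = {}")
  case True
  have "0 \<le> (ln K + 1) / \<delta> + 1" using K(2) \<delta> by (auto intro!: add_nonneg_nonneg divide_nonneg_nonneg)
  with True show ?thesis by (intro exI[of _ "{}"]) auto
next
  case False
  \<comment> \<open>A member of the family lies in \<open>U\<close> and has measure at least
    \<delta>, so \<delta> \<le> 1, as the greedy lemma requires.\<close>
  then obtain A0 where "A0 \<in> \<A>" by blast
  then have "\<delta> \<le> 1"
    using A[of A0] U measure_mono_fmeasurable[of A0 U lebesgue] by auto
  define m where "m = nat \<lceil>(ln K + 1) / \<delta>\<rceil>"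
  have pos: "0 < (ln K + 1) / \<delta>" using K(2) \<delta> by (simp add: add_nonneg_pos)
  have m: "(ln K + 1) / \<delta> \<le> real m" "real m \<le> (ln K + 1) / \<delta> + 1"
    unfolding m_def using pos by linarith+
  obtain N where N: "N \<subseteq> U" "finite N" "card N \<le> m"
    "real (card {A \<in> \<A>. A \<inter> N = {}}) \<le> (1 - \<delta>) ^ m * real (card \<A>)"
    using greedy_hitting_set[OF fin U A \<open>\<delta> \<le> 1\<close>] by blast
  have "(1 - \<delta>) ^ m \<le> exp (- \<delta>) ^ m"
    using \<open>\<delta> \<le> 1\<close> exp_ge_add_one_self[of "- \<delta>"] by (intro power_mono) auto
  also have "\<dots> = exp (- (\<delta> * real m))" by (simp add: exp_of_nat_mult[symmetric] mult.commute)
  also have "\<dots> < exp (- ln K)"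
    using m(1) \<delta> by (simp add: field_simps)
  also have "\<dots> = 1 / K" using K(2) by (simp add: exp_minus inverse_eq_divide)
  finally have "(1 - \<delta>) ^ m < 1 / K" .
  have "(1 - \<delta>) ^ m * real (card \<A>) \<le> (1 - \<delta>) ^ m * K"
    using K \<open>\<delta> \<le> 1\<close> by (intro mult_left_mono) auto
  also have "\<dots> < 1" using \<open>(1 - \<delta>) ^ m < 1 / K\<close> K(2) by (simp add: field_simps)
  finally have "card {A \<in> \<A>. A \<inter> N = {}} = 0" using N(4) by simp
  then have "\<forall>A\<in>\<A>. A \<inter> N \<noteq> {}" using fin by auto
  with N m(2) show ?thesis by (intro exI[of _ N]) auto
qed

section \<open>Boxes described by their corners\<close>

text \<open>Of the 2^d vertices, a base vertex (\<open>None\<close>) and its d neighbours are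
  enough: by affinity they determine the whole parametrisation of the box.\<close>

definition corner :: "(real ^ 'n \<Rightarrow> real ^ 'n) \<Rightarrow> real ^ 'n \<Rightarrow> real ^ 'n \<Rightarrow> 'n::finite option \<Rightarrow> real ^ 'n"
  where "corner f a b k =
    f (case k of None \<Rightarrow> a | Some i \<Rightarrow> a + (b $ i - a $ i) *\<^sub>R axis i 1)"

lemma euclidean_isometry_affine:
  assumes "euclidean_isometry f"
  shows "f (a + (\<Sum>i\<in>I. t i *\<^sub>R v i)) = f a + (\<Sum>i\<in>I. t i *\<^sub>R (f (a + v i) - f a))"
proof -
  define Q where "Q x = f x - f 0" for x
  interpret linear Q
    using euclidean_isometry_orthogonal[OF assms] unfolding Q_def
    by (rule orthogonal_transformation_linear)
  have f: "f x = f 0 + Q x" for x by (simp add: Q_def)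
  show ?thesis
    by (subst (1 2 3 4) f) (simp add: add sum scale)
qed

text \<open>With the edge vectors as displacements, the image depends only on the corners and the
  relative coordinates \<open>t\<close>, so two boxes can be compared at equal
  \<open>t\<close>.\<close>

lemma euclidean_isometry_corners:
  assumes "euclidean_isometry f"
  shows "f (\<chi> i. a $ i + t i * (b $ i - a $ i)) =
    corner f a b None + (\<Sum>i\<in>UNIV. t i *\<^sub>R (corner f a b (Some i) - corner f a b None))"
proof -
  have "(\<chi> i. a $ i + t i * (b $ i - a $ i)) =
      a + (\<Sum>i\<in>UNIV. t i *\<^sub>R ((b $ i - a $ i) *\<^sub>R axis i 1))"
    by (simp add: vec_eq_iff axis_def if_distrib cong: if_cong)
  then show ?thesis
    using euclidean_isometry_affine[OF assms, of a t "\<lambda>i. (b $ i - a $ i) *\<^sub>R axis i 1" UNIV]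
    by (simp add: corner_def)
qed

lemma corner_in_image_cbox:
  assumes "\<forall>i. a $ i \<le> b $ i"
  shows "corner f a b k \<in> f ` cbox a b"
  using assms by (auto simp: corner_def mem_box_cart axis_def intro!: imageI split: option.split)

text \<open>Keeping the middle half in every direction leaves room for perturbing the box and costs
  only a factor 2^d in volume.\<close>

definition core :: "real ^ 'n::finite \<Rightarrow> real ^ 'n \<Rightarrow> (real ^ 'n) set" where
  "core a b = cbox (\<chi> i. a $ i + (b $ i - a $ i) / 4) (\<chi> i. b $ i - (b $ i - a $ i) / 4)"

lemma core_subset:
  assumes "\<forall>i. a $ i \<le> b $ i"
  shows "core a b \<subseteq> cbox a b"
proof
  fix x assume "x \<in> core a b"
  then have x: "a $ i + (b $ i - a $ i) / 4 \<le> x $ i" "x $ i \<le> b $ i - (b $ i - a $ i) / 4" for i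
    by (auto simp: core_def mem_box_cart)
  have "a $ i \<le> x $ i \<and> x $ i \<le> b $ i" for i
    using x[of i] assms[rule_format, of i] by argo
  then show "x \<in> cbox a b" by (simp add: mem_box_cart)
qed

lemma measure_cbox_cart:
  fixes a b :: "real ^ 'n::finite"
  assumes "\<forall>i. a $ i \<le> b $ i"
  shows "measure lebesgue (cbox a b) = (\<Prod>i\<in>UNIV. b $ i - a $ i)"
proof -
  have "cbox a b \<noteq> {}" using assms by (auto simp: interval_ne_empty_cart)
  then show ?thesis by (simp add: content_cbox_cart)
qed

lemma measure_core:
  fixes a b :: "real ^ 'n::finite"
  assumes "\<forall>i. a $ i \<le> b $ i"
  shows "measure lebesgue (core a b) = measure lebesgue (cbox a b) / 2 ^ CARD('n)"
proof -
  have "a $ i + (b $ i - a $ i) / 4 \<le> b $ i - (b $ i - a $ i) / 4" for i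
    using assms[rule_format, of i] by argo
  then have "measure lebesgue (core a b) = (\<Prod>i\<in>UNIV. (b $ i - a $ i) / 2)"
    unfolding core_def by (subst measure_cbox_cart) (auto intro!: prod.cong simp: field_split_simps)
  then show ?thesis by (simp add: measure_cbox_cart[OF assms] prod_dividef)
qed

text \<open>An isometry is determined affinely by the corners, so nearby corners give nearby
  parametrisations, and the margin of the core absorbs the difference.\<close>
lemma core_image_subset_box:
  fixes f g :: "real ^ 'n::finite \<Rightarrow> real ^ 'n"
  assumes f: "euclidean_isometry f" and g: "euclidean_isometry g"
    and ab: "\<forall>i. a $ i < b $ i" and cd: "\<forall>i. \<eta> \<le> d $ i - c $ i"
    and near: "\<And>k. norm (corner f a b k - corner g c d k) \<le> \<rho>"
    and \<eta>: "0 < \<eta>" "(2 * real CARD('n) + 1) * \<rho> \<le> \<eta> / 4"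
  shows "f ` core a b \<subseteq> g ` cbox c d"
proof
  fix y assume "y \<in> f ` core a b"
  then obtain p where p: "p \<in> core a b" "y = f p" by blast
  define t where "t i = (p $ i - a $ i) / (b $ i - a $ i)" for i
  have p_eq: "p = (\<chi> i. a $ i + t i * (b $ i - a $ i))"
    using ab by (auto simp: t_def vec_eq_iff) (metis less_irrefl)
  have t: "1 / 4 \<le> t i" "t i \<le> 3 / 4" for i
  proof -
    have "a $ i < b $ i" using ab by blast
    then show "1 / 4 \<le> t i" "t i \<le> 3 / 4"
      using p(1) by (auto simp: core_def mem_box_cart t_def field_simps)
  qed
  \<comment> \<open>\<open>q\<close> has the same relative coordinates in the second box. The corner
    errors add up to at most \<rho> for the base vertex and 2 \<rho> for each edge.\<close>
  define q where "q = (\<chi> i. c $ i + t i * (d $ i - c $ i))"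
  define u where "u k = corner f a b k - corner g c d k" for k
  have u: "norm (u k) \<le> \<rho>" for k using near by (simp add: u_def)
  have "f p - g q = u None + (\<Sum>i\<in>UNIV. t i *\<^sub>R (u (Some i) - u None))"
    unfolding p_eq q_def euclidean_isometry_corners[OF f] euclidean_isometry_corners[OF g] u_def
    by (simp add: sum_subtractf[symmetric] algebra_simps)
  also have "norm \<dots> \<le> \<rho> + (\<Sum>i\<in>(UNIV :: 'n set). 2 * \<rho>)"
  proof (intro norm_triangle_mono u sum_norm_le)
    fix i
    have "norm (t i *\<^sub>R (u (Some i) - u None)) \<le> 1 * norm (u (Some i) - u None)"
      unfolding norm_scaleR using t[of i] by (intro mult_right_mono) auto
    also have "\<dots> \<le> 2 * \<rho>"
      using norm_triangle_ineq4[of "u (Some i)" "u None"] u[of "Some i"] u[of None] by linarith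
    finally show "norm (t i *\<^sub>R (u (Some i) - u None)) \<le> 2 * \<rho>" .
  qed
  also have "\<dots> \<le> \<eta> / 4" using \<eta>(2) by (simp add: algebra_simps)
  finally have fg: "norm (f p - g q) \<le> \<eta> / 4" .
  \<comment> \<open>Pulled back by \<open>g\<close>, the point lies within \<eta>/4 of
    \<open>q\<close>; as all sides are at least \<eta> and \<open>t\<close> lies between 1/4 and
    3/4, \<open>q\<close> is at least that far from every face.\<close>
  have "surj g" using g by (simp add: euclidean_isometry_def bij_def)
  then obtain z where z: "y = g z" by (rule surjE)
  have "norm (z - q) = norm (g z - g q)"
    using g by (simp add: euclidean_isometry_def dist_norm)
  then have zq: "norm (z - q) \<le> \<eta> / 4" using fg z p(2) by simp
  have "c $ i \<le> z $ i \<and> z $ i \<le> d $ i" for i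
  proof -
    define e where "e = d $ i - c $ i"
    have e: "\<eta> \<le> e" using cd by (simp add: e_def)
    have "\<bar>z $ i - q $ i\<bar> \<le> \<eta> / 4"
      using component_le_norm_cart[of "z - q" i] zq by simp
    moreover have "q $ i = c $ i + t i * e" by (simp add: q_def e_def)
    moreover have "1 / 4 * e \<le> t i * e" "t i * e \<le> 3 / 4 * e"
      using t[of i] e \<eta>(1) by (auto intro!: mult_right_mono)
    moreover have "d $ i = c $ i + e" by (simp add: e_def)
    ultimately show ?thesis using e by (intro conjI) linarith+
  qed
  then show "y \<in> g ` cbox c d" unfolding z by (intro imageI) (simp add: mem_box_cart)
qed

section \<open>Finitely many sets that serve all large boxes\<close>

lemma unit_cube_abs_le: "x \<in> unit_cube \<Longrightarrow> \<bar>x $ j\<bar> \<le> 1 / 2"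
  by (auto simp: unit_cube_def mem_box_cart abs_le_iff dest!: spec[of _ j])

text \<open>Two corners in the cube differ by at most 1 per coordinate, so every side is at most d
  and one short side would force a small volume. The exponent d - 1 from the other sides is rounded
  up to d.\<close>

lemma unit_cube_box_side_bound:
  fixes f :: "real ^ 'n::finite \<Rightarrow> real ^ 'n"
  assumes f: "euclidean_isometry f" and ab: "\<forall>i. a $ i \<le> b $ i"
    and sub: "f ` cbox a b \<subseteq> unit_cube" and \<epsilon>: "\<epsilon> \<le> measure lebesgue (f ` cbox a b)"
  shows "\<epsilon> / real CARD('n) ^ CARD('n) \<le> b $ i - a $ i"
proof -
  let ?d = "real CARD('n)"
  have d1: "1 \<le> ?d" by (simp add: Suc_leI)
  have side: "b $ j - a $ j \<le> ?d" for j
  proof -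
    have "b $ j - a $ j = norm (corner f a b (Some j) - corner f a b None)"
      using f ab by (simp add: corner_def euclidean_isometry_def dist_norm)
    also have "\<dots> \<le> (\<Sum>k\<in>UNIV. \<bar>(corner f a b (Some j) - corner f a b None) $ k\<bar>)"
      by (rule norm_le_l1_cart)
    also have "\<dots> \<le> (\<Sum>k\<in>(UNIV::'n set). 1)"
    proof (rule sum_mono)
      fix k
      have "\<bar>corner f a b m $ k\<bar> \<le> 1 / 2" for m
        using unit_cube_abs_le corner_in_image_cbox[OF ab, of f m] sub by blast
      from this[of "Some j"] this[of None]
      show "\<bar>(corner f a b (Some j) - corner f a b None) $ k\<bar> \<le> 1" by simp
    qed
    finally show ?thesis by simp
  qed
  have "\<epsilon> \<le> (\<Prod>j\<in>UNIV. b $ j - a $ j)"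
    using \<epsilon> by (simp only: measure_euclidean_isometry_cbox[OF f] measure_cbox_cart[OF ab])
  also have "\<dots> = (b $ i - a $ i) * (\<Prod>j\<in>UNIV - {i}. b $ j - a $ j)"
    by (rule prod.remove) auto
  also have "\<dots> \<le> (b $ i - a $ i) * (\<Prod>j\<in>UNIV - {i}. ?d)"
    using side ab by (intro mult_left_mono prod_mono) auto
  also have "\<dots> \<le> (b $ i - a $ i) * ?d ^ CARD('n)"
    using ab d1 by (intro mult_left_mono) (auto intro!: power_increasing)
  finally show ?thesis using d1 by (simp add: divide_le_eq)
qed

text \<open>Boxes are classified by their corners rounded to a mesh \<open>h\<close> proportional to \<open>\<epsilon>\<close>; the core of
  one representative per class lies in all boxes of that class.\<close>
lemma unit_cube_boxes_finite_cover:
  fixes \<epsilon> :: real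
  assumes \<epsilon>: "0 < \<epsilon>" "\<epsilon> \<le> 1"
  defines "D \<equiv> CARD('n::finite)"
  shows "\<exists>\<A> :: (real ^ 'n) set set. finite \<A> \<and>
    real (card \<A>) \<le> (60 * real D ^ (D + 2) / \<epsilon>) ^ (Suc D * D) \<and>
    (\<forall>A\<in>\<A>. A \<in> lmeasurable \<and> A \<subseteq> unit_cube \<and> \<epsilon> / 2 ^ D \<le> measure lebesgue A) \<and>
    (\<forall>s B. box_with_sides s B \<and> B \<subseteq> unit_cube \<and> \<epsilon> \<le> measure lebesgue B \<longrightarrow> (\<exists>A\<in>\<A>. A \<subseteq> B))"
proof -
  \<comment> \<open>The mesh makes the corner error \<open>D * h\<close> small enough for
    \<open>core_image_subset_box\<close>: (2 D + 1) D h \<le> 3 D^2 h = \<epsilon> / (4 D^D), a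
    quarter of the lower bound on the sides.\<close>
  define h where "h = \<epsilon> / (12 * real D ^ (D + 2))"
  have D1: "1 \<le> real D" by (simp add: D_def Suc_leI)
  have h: "0 < h" "h \<le> 1 / 12"
  proof -
    show "0 < h" using \<epsilon> D1 by (simp add: h_def)
    have "1 \<le> real D ^ (D + 2)" using D1 by (rule one_le_power)
    then show "h \<le> 1 / 12" using \<epsilon> by (simp add: h_def field_simps)
  qed
  define \<B> :: "((real ^ 'n \<Rightarrow> real ^ 'n) \<times> (real ^ 'n) \<times> (real ^ 'n)) set" where
    "\<B> = {(f, a, b). euclidean_isometry f \<and> (\<forall>i. a $ i \<le> b $ i) \<and>
      f ` cbox a b \<subseteq> unit_cube \<and> \<epsilon> \<le> measure lebesgue (f ` cbox a b)}"
  \<comment> \<open>D floors for each of D + 1 corners: hence the exponent \<open>Suc D * D\<close>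
    in the count.\<close>
  define code :: "((real ^ 'n \<Rightarrow> real ^ 'n) \<times> (real ^ 'n) \<times> (real ^ 'n)) \<Rightarrow> ('n option \<times> 'n) \<Rightarrow> int"
    where "code = (\<lambda>(f, a, b) (k, j). \<lfloor>corner f a b k $ j / h\<rfloor>)"
  \<comment> \<open>The choice is constrained only when \<open>\<kappa>\<close> is the code of some
    box in \<open>\<B>\<close>; \<open>\<A>\<close> uses it for those codes alone.\<close>
  define rep where "rep \<kappa> = (SOME \<tau>. \<tau> \<in> \<B> \<and> code \<tau> = \<kappa>)" for \<kappa>
  have rep: "rep (code \<tau>) \<in> \<B>" "code (rep (code \<tau>)) = code \<tau>" if "\<tau> \<in> \<B>" for \<tau>
    using someI[of "\<lambda>\<sigma>. \<sigma> \<in> \<B> \<and> code \<sigma> = code \<tau>" \<tau>] that unfolding rep_def by auto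
  define co :: "((real ^ 'n \<Rightarrow> real ^ 'n) \<times> (real ^ 'n) \<times> (real ^ 'n)) \<Rightarrow> (real ^ 'n) set"
    where "co = (\<lambda>(f, a, b). f ` core a b)"
  define \<A> where "\<A> = (\<lambda>\<kappa>. co (rep \<kappa>)) ` code ` \<B>"
  define m where "m = \<lceil>1 / h\<rceil>"
  have codes: "code ` \<B> \<subseteq> UNIV \<rightarrow>\<^sub>E {- m..m}"
  proof
    fix \<kappa> assume "\<kappa> \<in> code ` \<B>"
    then obtain f a b where fab: "(f, a, b) \<in> \<B>" "\<kappa> = code (f, a, b)" by auto
    have "\<kappa> (k, j) \<in> {- m..m}" for k j
    proof -
      have "\<bar>corner f a b k $ j\<bar> \<le> 1 / 2"
        using unit_cube_abs_le corner_in_image_cbox[of a b f k] fab(1) unfolding \<B>_def by blast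
      then have "\<bar>corner f a b k $ j / h\<bar> \<le> (1 / 2) / h"
        using h(1) by (simp add: field_simps)
      moreover have "12 \<le> 1 / h" using h by (simp add: field_simps)
      moreover have "1 / h \<le> of_int m" unfolding m_def by linarith
      ultimately have "\<bar>corner f a b k $ j / h\<bar> + 1 \<le> of_int m" by simp
      then have "- m \<le> \<lfloor>corner f a b k $ j / h\<rfloor>" "\<lfloor>corner f a b k $ j / h\<rfloor> \<le> m"
        by linarith+
      then show ?thesis unfolding fab(2) code_def by simp
    qed
    then show "\<kappa> \<in> UNIV \<rightarrow>\<^sub>E {- m..m}" by auto
  qed
  have m: "0 \<le> m" unfolding m_def using h(1) by (simp add: zero_le_ceiling) (smt (verit) divide_pos_pos)
  have fin: "finite (UNIV \<rightarrow>\<^sub>E {- m..m} :: ('n option \<times> 'n \<Rightarrow> int) set)" by (intro finite_PiE) auto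
  then have fin': "finite (code ` \<B>)" using codes finite_subset by blast
  have "card \<A> \<le> card (code ` \<B>)" unfolding \<A>_def by (rule card_image_le[OF fin'])
  also have "\<dots> \<le> card (UNIV \<rightarrow>\<^sub>E {- m..m} :: ('n option \<times> 'n \<Rightarrow> int) set)"
    by (rule card_mono[OF fin codes])
  also have "\<dots> = nat (2 * m + 1) ^ (Suc D * D)"
    using m by (simp add: card_funcsetE card_option D_def algebra_simps)
  finally have "real (card \<A>) \<le> real (nat (2 * m + 1)) ^ (Suc D * D)"
    unfolding of_nat_power[symmetric] by (rule of_nat_mono)
  \<comment> \<open>\<open>2 * m + 1 \<le> 2 / h + 3 \<le> 5 / h\<close>; together with the 12 in
    \<open>h\<close> this gives the constant 60.\<close>
  also have "\<dots> \<le> (5 / h) ^ (Suc D * D)"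
  proof (rule power_mono)
    have "12 \<le> 1 / h" using h by (simp add: field_simps)
    moreover have "of_int m \<le> 1 / h + 1" unfolding m_def by linarith
    moreover have "real (nat (2 * m + 1)) = 2 * of_int m + 1" using m by simp
    ultimately show "real (nat (2 * m + 1)) \<le> 5 / h" by simp
  qed auto
  also have "5 / h = 60 * real D ^ (D + 2) / \<epsilon>" unfolding h_def by simp
  finally have card: "real (card \<A>) \<le> (60 * real D ^ (D + 2) / \<epsilon>) ^ (Suc D * D)" .
  have props: "A \<in> lmeasurable \<and> A \<subseteq> unit_cube \<and> \<epsilon> / 2 ^ D \<le> measure lebesgue A" if "A \<in> \<A>" for A
  proof -
    obtain \<tau> where "\<tau> \<in> \<B>" "A = co (rep (code \<tau>))" using \<open>A \<in> \<A>\<close> unfolding \<A>_def by blast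
    moreover obtain f a b where fab: "rep (code \<tau>) = (f, a, b)" by (metis prod_cases3)
    ultimately have *: "(f, a, b) \<in> \<B>" and A: "A = f ` core a b"
      using rep(1) by (fastforce simp: co_def)+
    from * have f: "euclidean_isometry f" and ab: "\<forall>i. a $ i \<le> b $ i" and
      sub: "f ` cbox a b \<subseteq> unit_cube" and eps: "\<epsilon> \<le> measure lebesgue (f ` cbox a b)"
      by (auto simp: \<B>_def)
    have "measure lebesgue A = measure lebesgue (core a b)"
      unfolding A core_def by (rule measure_euclidean_isometry_cbox[OF f])
    then have "\<epsilon> / 2 ^ D \<le> measure lebesgue A"
      using eps measure_euclidean_isometry_cbox[OF f, of a b]
      by (simp only: measure_core[OF ab] D_def) (simp add: divide_right_mono)
    moreover have "A \<in> lmeasurable"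
      unfolding A core_def by (rule lmeasurable_euclidean_isometry_cbox[OF f])
    moreover have "A \<subseteq> unit_cube" unfolding A using core_subset[OF ab] sub by blast
    ultimately show ?thesis by blast
  qed
  \<comment> \<open>A box and the representative of its code have equal floors, so their corners
    differ by at most \<open>h\<close> per coordinate and the core of the representative lies in the
    box.\<close>
  have cover: "\<exists>A\<in>\<A>. A \<subseteq> B"
    if B: "box_with_sides s B" "B \<subseteq> unit_cube" "\<epsilon> \<le> measure lebesgue B" for s B
  proof -
    obtain g c d where gcd: "euclidean_isometry g" "\<forall>i. c $ i \<le> d $ i" "B = g ` cbox c d"
      using B(1) by (auto simp: box_with_sides_def)
    then have \<sigma>: "(g, c, d) \<in> \<B>" using B by (simp add: \<B>_def)
    obtain f a b where fab: "rep (code (g, c, d)) = (f, a, b)" by (metis prod_cases3)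
    then have "(f, a, b) \<in> \<B>" and same: "code (f, a, b) = code (g, c, d)"
      using rep[OF \<sigma>] by auto
    then have f: "euclidean_isometry f" and ab: "\<forall>i. a $ i \<le> b $ i" and
      sub: "f ` cbox a b \<subseteq> unit_cube" and eps: "\<epsilon> \<le> measure lebesgue (f ` cbox a b)"
      by (auto simp: \<B>_def)
    define \<eta> where "\<eta> = \<epsilon> / real D ^ D"
    have \<eta>: "0 < \<eta>" using \<epsilon> D1 by (simp add: \<eta>_def)
    have "\<eta> \<le> b $ i - a $ i" for i
      unfolding \<eta>_def D_def by (rule unit_cube_box_side_bound[OF f ab sub eps])
    with \<eta> have ab': "\<forall>i. a $ i < b $ i" by (metis diff_gt_0_iff_gt order_less_le_trans)
    have cd: "\<forall>i. \<eta> \<le> d $ i - c $ i"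
      unfolding \<eta>_def D_def using unit_cube_box_side_bound[OF gcd(1,2)] B(2,3) gcd(3) by blast
    have near: "norm (corner f a b k - corner g c d k) \<le> real D * h" for k
    proof -
      have "\<bar>(corner f a b k - corner g c d k) $ j\<bar> \<le> h" for j
      proof -
        have "\<lfloor>corner f a b k $ j / h\<rfloor> = \<lfloor>corner g c d k $ j / h\<rfloor>"
          using fun_cong[OF same, of "(k, j)"] by (simp add: code_def)
        then have "\<bar>corner f a b k $ j / h - corner g c d k $ j / h\<bar> \<le> 1" by linarith
        then have "\<bar>corner f a b k $ j - corner g c d k $ j\<bar> / h \<le> 1"
          using h(1) by (simp add: diff_divide_distrib[symmetric])
        then show ?thesis using h(1) by (simp add: field_simps)
      qed
      then have "(\<Sum>j\<in>UNIV. \<bar>(corner f a b k - corner g c d k) $ j\<bar>) \<le> (\<Sum>j\<in>(UNIV::'n set). h)"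
        by (intro sum_mono)
      then show ?thesis using norm_le_l1_cart[of "corner f a b k - corner g c d k"] by (simp add: D_def)
    qed
    have "(2 * real D + 1) * (real D * h) \<le> (3 * real D) * (real D * h)"
      using D1 h(1) by (intro mult_right_mono) auto
    also have "\<dots> = \<eta> / 4" using D1 by (simp add: h_def \<eta>_def field_simps power2_eq_square power_add)
    finally have "f ` core a b \<subseteq> g ` cbox c d"
      using core_image_subset_box[OF f gcd(1) ab' cd near \<eta>] unfolding D_def by blast
    moreover have "f ` core a b \<in> \<A>"
      unfolding \<A>_def using \<sigma> fab by (force simp: co_def intro!: image_eqI[of _ _ "code (g, c, d)"])
    ultimately show ?thesis using gcd(3) by blast
  qed
  have "finite \<A>" unfolding \<A>_def using fin' by blast
  with card props cover show ?thesis by blast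
qed

section \<open>Nets in the unit cube\<close>

lemma unit_cube_measure: "unit_cube \<in> lmeasurable" "measure lebesgue (unit_cube :: (real ^ 'n::finite) set) = 1"
  unfolding unit_cube_def by (simp, subst measure_cbox_cart) auto

lemma zero_in_unit_cube: "0 \<in> unit_cube"
  by (simp add: unit_cube_def mem_box_cart)

text \<open>The number of classes is polynomial in 1/\<epsilon>, so its logarithm is O(ln
  (1/\<epsilon>)), and the greedy bound is applied with \<delta> = \<epsilon> / 2^D. For \<epsilon>
  \<le> 1/2 the logarithm stays away from 0 and absorbs constants.\<close>

lemma unit_cube_hitting_set:
  shows "\<exists>C>0. \<forall>\<epsilon>. 0 < \<epsilon> \<and> \<epsilon> \<le> 1 / 2 \<longrightarrow> (\<exists>N :: (real ^ 'n::finite) set.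
    N \<subseteq> unit_cube \<and> finite N \<and> real (card N) \<le> C * ((1 / \<epsilon>) * ln (1 / \<epsilon>)) \<and>
    (\<forall>s B. box_with_sides s B \<and> B \<subseteq> unit_cube \<and> \<epsilon> \<le> measure lebesgue B \<longrightarrow> N \<inter> B \<noteq> {}))"
proof -
  define D where "D = CARD('n)"
  define E where "E = real (Suc D * D)"
  define A where "A = 60 * real D ^ (D + 2)"
  \<comment> \<open>In the greedy bound every term without a logarithm is multiplied by 2 ln
    (1/\<epsilon>) \<ge> 1; \<open>C\<close> collects the resulting coefficients.\<close>
  define C where "C = 2 ^ D * (2 * E * ln A + E + 2) + 2"
  have D1: "1 \<le> real D" by (simp add: D_def Suc_leI)
  have "1 \<le> real D ^ (D + 2)" using D1 by (rule one_le_power)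
  then have A1: "1 \<le> A" by (simp add: A_def)
  then have lnA: "0 \<le> ln A" by simp
  have E0: "0 \<le> E" by (simp add: E_def)
  have "C > 0" unfolding C_def using lnA E0 by (intro add_nonneg_pos mult_nonneg_nonneg add_nonneg_nonneg) auto
  moreover have "\<exists>N :: (real ^ 'n) set.
    N \<subseteq> unit_cube \<and> finite N \<and> real (card N) \<le> C * ((1 / \<epsilon>) * ln (1 / \<epsilon>)) \<and>
    (\<forall>s B. box_with_sides s B \<and> B \<subseteq> unit_cube \<and> \<epsilon> \<le> measure lebesgue B \<longrightarrow> N \<inter> B \<noteq> {})"
    if \<epsilon>: "0 < \<epsilon>" "\<epsilon> \<le> 1 / 2" for \<epsilon>
  proof -
    obtain \<A> :: "(real ^ 'n) set set" where fin: "finite \<A>"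
      and card: "real (card \<A>) \<le> (A / \<epsilon>) ^ (Suc D * D)"
      and props: "\<forall>A\<in>\<A>. A \<in> lmeasurable \<and> A \<subseteq> unit_cube \<and> \<epsilon> / 2 ^ D \<le> measure lebesgue A"
      and cover: "\<And>s B. box_with_sides s B \<and> B \<subseteq> unit_cube \<and> \<epsilon> \<le> measure lebesgue B \<Longrightarrow> \<exists>A\<in>\<A>. A \<subseteq> B"
      using unit_cube_boxes_finite_cover[where 'n = 'n, of \<epsilon>] \<epsilon> unfolding D_def A_def by auto
    define l where "l = ln (1 / \<epsilon>)"
    have l: "1 / 2 \<le> l"
      using ln_le_minus_one[of \<epsilon>] \<epsilon> by (simp add: l_def ln_div)
    have "1 \<le> A / \<epsilon>" using A1 \<epsilon> by (simp add: field_simps)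
    then have K1: "1 \<le> (A / \<epsilon>) ^ (Suc D * D)" by (rule one_le_power)
    have props': "A \<in> sets lebesgue \<and> A \<subseteq> unit_cube \<and> \<epsilon> / 2 ^ D \<le> measure lebesgue A"
      if "A \<in> \<A>" for A using props that by (auto intro: fmeasurableD)
    have ne: "(unit_cube :: (real ^ 'n) set) \<noteq> {}" using zero_in_unit_cube by blast
    obtain N where N: "N \<subseteq> unit_cube" "finite N" "\<forall>A\<in>\<A>. A \<inter> N \<noteq> {}"
      "real (card N) \<le> (ln ((A / \<epsilon>) ^ (Suc D * D)) + 1) / (\<epsilon> / 2 ^ D) + 1"
      using hitting_set_bound[OF fin unit_cube_measure(1) _ ne props' _ card K1] \<epsilon>
      by (auto simp: unit_cube_measure(2))
    have "ln ((A / \<epsilon>) ^ (Suc D * D)) = E * (ln A + l)"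
      using A1 \<epsilon> by (simp add: ln_realpow E_def l_def ln_div)
    then have "real (card N) \<le> (E * (ln A + l) + 1) / (\<epsilon> / 2 ^ D) + 1" using N(4) by simp
    also have "\<dots> = (1 / \<epsilon>) * (2 ^ D * (E * ln A * 1 + E * l + 1)) + 1 * 1" by (simp add: field_simps)
    also have "\<dots> \<le> (1 / \<epsilon>) * (2 ^ D * (E * ln A * (2 * l) + E * l + 2 * l)) + (1 / \<epsilon>) * (2 * l)"
      using l \<epsilon> lnA E0 by (intro add_mono mult_mono mult_left_mono) (auto intro!: mult_nonneg_nonneg add_nonneg_nonneg)
    also have "\<dots> = C * ((1 / \<epsilon>) * l)" by (simp add: C_def field_simps add_divide_distrib)
    finally have "real (card N) \<le> C * ((1 / \<epsilon>) * ln (1 / \<epsilon>))" unfolding l_def .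
    moreover have "N \<inter> B \<noteq> {}"
      if "box_with_sides s B \<and> B \<subseteq> unit_cube \<and> \<epsilon> \<le> measure lebesgue B" for s B
      using cover[OF that] N(3) by blast
    ultimately show ?thesis using N(1,2) by blast
  qed
  ultimately show ?thesis by blast
qed

section \<open>An optical forest from scaled nets\<close>

text \<open>The witness is [0, L] x [-r, r]^(d-1), rotated so that the side of length
  \<open>L\<close> points along \<open>u\<close> and moved to start at \<open>p\<close>. Its points
  are off that axis by at most \<open>r\<close> in each other coordinate, and the l1 norm bounds the
  distance.\<close>

lemma box_around_segment:
  fixes p u :: "real ^ 'n::finite"
  assumes d: "CARD('n) \<ge> 2" and u: "norm u = 1" and r: "0 < r" and L: "0 \<le> L"
  shows "\<exists>s B. box_with_sides s B \<and> measure lebesgue B = L * (2 * r) ^ (CARD('n) - 1) \<and>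
    (\<forall>y\<in>B. \<exists>t\<in>{0..L}. dist y (p + t *\<^sub>R u) \<le> real CARD('n) * r)"
proof -
  obtain k :: 'n where True by blast
  have k: "norm (axis k 1 :: real ^ 'n) = 1" by simp
  obtain Q where Q: "orthogonal_transformation Q" "det (matrix Q) = 1" "Q (axis k 1) = u"
    by (rule rotation_exists_1[OF d k u])
  interpret linear Q using Q(1) by (rule orthogonal_transformation_linear)
  define a b :: "real ^ 'n" where "a = (\<chi> i. if i = k then 0 else - r)"
    and "b = (\<chi> i. if i = k then L else r)"
  have ab: "\<forall>i. a $ i \<le> b $ i" using r L by (simp add: a_def b_def)
  define f where "f x = p + Q x" for x
  have f: "euclidean_isometry f" unfolding f_def by (rule orthogonal_euclidean_isometry[OF Q(1)])
  have "measure lebesgue (f ` cbox a b) = (\<Prod>i\<in>UNIV. b $ i - a $ i)"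
    using measure_euclidean_isometry_cbox[OF f] measure_cbox_cart[OF ab] by metis
  also have "\<dots> = (b $ k - a $ k) * (\<Prod>i\<in>UNIV - {k}. b $ i - a $ i)"
    by (rule prod.remove) auto
  also have "(\<Prod>i\<in>UNIV - {k}. b $ i - a $ i) = (\<Prod>i\<in>UNIV - {k}. 2 * r)"
    by (rule prod.cong) (auto simp: a_def b_def)
  finally have m: "measure lebesgue (f ` cbox a b) = L * (2 * r) ^ (CARD('n) - 1)"
    by (simp add: a_def b_def)
  have near: "\<exists>t\<in>{0..L}. dist y (p + t *\<^sub>R u) \<le> real CARD('n) * r" if "y \<in> f ` cbox a b" for y
  proof -
    obtain x where x: "x \<in> cbox a b" "y = p + Q x" using \<open>y \<in> f ` cbox a b\<close> by (auto simp: f_def)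
    have "dist y (p + x $ k *\<^sub>R u) = norm (Q (x - x $ k *\<^sub>R axis k 1))"
      by (simp add: x(2) dist_norm diff scale Q(3))
    also have "\<dots> = norm (x - x $ k *\<^sub>R axis k 1)"
      using Q(1) by (simp add: orthogonal_transformation)
    also have "\<dots> \<le> (\<Sum>i\<in>UNIV. \<bar>(x - x $ k *\<^sub>R axis k 1) $ i\<bar>)" by (rule norm_le_l1_cart)
    also have "\<dots> \<le> (\<Sum>i\<in>(UNIV :: 'n set). r)"
    proof (rule sum_mono)
      fix i
      have "a $ i \<le> x $ i" "x $ i \<le> b $ i" using x(1) by (auto simp: mem_box_cart)
      then show "\<bar>(x - x $ k *\<^sub>R axis k 1) $ i\<bar> \<le> r"
        using r by (auto simp: axis_def a_def b_def abs_le_iff split: if_splits)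
    qed
    finally have "dist y (p + x $ k *\<^sub>R u) \<le> real CARD('n) * r" by simp
    moreover have "x $ k \<in> {0..L}"
      using x(1) by (auto simp: mem_box_cart a_def b_def dest!: spec[of _ k])
    ultimately show ?thesis by blast
  qed
  have "box_with_sides (b - a) (f ` cbox a b)"
    unfolding box_with_sides_def using f ab by blast
  with m near show ?thesis by blast
qed

lemma power_two_bracket:
  fixes x :: real
  assumes "1 \<le> x"
  shows "\<exists>m. 2 ^ m \<le> x \<and> x < 2 ^ Suc m"
proof -
  have ex: "\<exists>n. x < 2 ^ n" using real_arch_pow[of 2 x] by simp
  define n where "n = (LEAST n. x < 2 ^ n)"
  have n: "x < 2 ^ n" unfolding n_def using ex by (rule LeastI_ex)
  then obtain m where m: "n = Suc m" using assms by (cases n) auto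
  have "\<not> x < 2 ^ m" using not_less_Least[of m "\<lambda>n. x < 2 ^ n"] m by (simp add: n_def)
  with n m show ?thesis by (intro exI[of _ m]) auto
qed

lemma sum_power_Suc_le:
  fixes a :: real
  assumes "2 \<le> a"
  shows "(\<Sum>k\<le>m. a ^ Suc k) \<le> 2 * a ^ Suc m"
proof (induction m)
  case (Suc m)
  have "2 * a ^ Suc m \<le> a * a ^ Suc m" using assms by (intro mult_right_mono) auto
  with Suc show ?case by simp
qed (use assms in simp)

text \<open>Dyadic shells: the net scaled to the cube of side \<open>2 ^ Suc k\<close> is kept only at norms at least
  \<open>2 ^ k / 8\<close>, so a ball of radius \<open>T\<close> meets only \<open>O(ln T)\<close> of the pieces.\<close>
definition shell_union :: "(nat \<Rightarrow> (real ^ 'n::finite) set) \<Rightarrow> (real ^ 'n) set" where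
  "shell_union N = (\<Union>k. {x \<in> (\<lambda>y. 2 ^ Suc k *\<^sub>R y) ` N k. 2 ^ k \<le> 8 * norm x})"

lemma cball_shell_union_subset:
  assumes "8 * T < 2 ^ Suc m"
  shows "cball 0 T \<inter> shell_union N \<subseteq> (\<Union>k\<le>m. (\<lambda>y. 2 ^ Suc k *\<^sub>R y) ` N k)"
proof
  fix x assume "x \<in> cball 0 T \<inter> shell_union N"
  then have "x \<in> shell_union N" "norm x \<le> T" by auto
  then obtain k where k: "x \<in> (\<lambda>y. 2 ^ Suc k *\<^sub>R y) ` N k" "2 ^ k \<le> 8 * norm x"
    unfolding shell_union_def by blast
  with \<open>norm x \<le> T\<close> have "(2 :: real) ^ k < 2 ^ Suc m" using assms by linarith
  then have "k < Suc m" by (rule power_less_imp_less_exp[rotated]) simp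
  with k(1) show "x \<in> (\<Union>k\<le>m. (\<lambda>y. 2 ^ Suc k *\<^sub>R y) ` N k)" by auto
qed

text \<open>Only pieces with 2^k \<le> 8 T meet the ball, and the bounds on their sizes grow
  geometrically. The last one dominates, so summing O(ln T) pieces costs a constant factor and not a
  second logarithm.\<close>

lemma shell_union_growth:
  fixes N :: "nat \<Rightarrow> (real ^ 'n::finite) set" and D :: nat
  assumes fin: "\<And>k. finite (N k)" and D: "1 \<le> D" and C: "0 \<le> C"
    and card: "\<And>k. real (card (N k)) \<le> C * ((2 ^ D) ^ Suc k * ln ((2 ^ D) ^ Suc k))"
  shows "has_growth_rate (shell_union N) (\<lambda>T. T ^ D * ln T)"
proof -
  have fin_union: "finite (\<Union>k\<le>m. (\<lambda>y. 2 ^ Suc k *\<^sub>R y) ` N k)" for m using fin by simp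
  have "finite (cball 0 T \<inter> shell_union N)" for T
  proof -
    obtain n where "8 * T < 2 ^ n" using real_arch_pow[of 2 "8 * T"] by auto
    then have "8 * T < 2 ^ Suc n" by (simp add: field_simps) (smt (verit) zero_le_power)
    from finite_subset[OF cball_shell_union_subset[OF this] fin_union] show ?thesis .
  qed
  moreover have "(\<lambda>T. real (card (cball 0 T \<inter> shell_union N))) \<in> O[at_top](\<lambda>T. T ^ D * ln T)"
  \<comment> \<open>For T \<ge> 16, \<open>ln (16 * T) \<le> 2 * ln T\<close> gives one factor 2,
    the geometric sum gives the other, and \<open>2 ^ Suc m \<le> 16 * T\<close> gives
    \<open>16 ^ D\<close>.\<close>
  proof (rule bigoI[where c = "C * real D * 2 * 16 ^ D * 2"], rule eventually_at_top_linorderI[of 16])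
    fix T :: real assume T: "16 \<le> T"
    obtain m where m: "2 ^ m \<le> 8 * T" "8 * T < 2 ^ Suc m"
      using power_two_bracket[of "8 * T"] T by auto
    have "card (cball 0 T \<inter> shell_union N) \<le> card (\<Union>k\<le>m. (\<lambda>y. 2 ^ Suc k *\<^sub>R y) ` N k)"
      by (rule card_mono[OF fin_union cball_shell_union_subset[OF m(2)]])
    also have "\<dots> \<le> (\<Sum>k\<le>m. card ((\<lambda>y. 2 ^ Suc k *\<^sub>R y) ` N k))"
      by (rule card_UN_le) simp
    also have "\<dots> \<le> (\<Sum>k\<le>m. card (N k))" by (intro sum_mono card_image_le fin)
    finally have "real (card (cball 0 T \<inter> shell_union N)) \<le> (\<Sum>k\<le>m. real (card (N k)))"
      unfolding of_nat_sum[symmetric] by (rule of_nat_mono)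
    also have "\<dots> \<le> (\<Sum>k\<le>m. C * real D * ln (16 * T) * (2 ^ D) ^ Suc k)"
    proof (rule sum_mono)
      fix k assume "k \<in> {..m}"
      then have "(2 :: real) ^ Suc k \<le> 2 ^ Suc m" by (intro power_increasing) auto
      then have "(2 :: real) ^ Suc k \<le> 16 * T" using m(1) unfolding power_Suc by linarith
      then have "ln ((2 :: real) ^ Suc k) \<le> ln (16 * T)" using T by (subst ln_le_cancel_iff) auto
      then have "real D * ln ((2 :: real) ^ Suc k) \<le> real D * ln (16 * T)" by (intro mult_left_mono) auto
      moreover have "ln (((2 :: real) ^ D) ^ Suc k) = real D * ln (2 ^ Suc k)"
        by (simp add: ln_realpow mult.left_commute del: power_Suc)
      ultimately have "ln (((2 :: real) ^ D) ^ Suc k) \<le> real D * ln (16 * T)" by simp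
      then have "(2 ^ D) ^ Suc k * ln (((2 :: real) ^ D) ^ Suc k) \<le> (2 ^ D) ^ Suc k * (real D * ln (16 * T))"
        by (intro mult_left_mono) auto
      then have "C * ((2 ^ D) ^ Suc k * ln ((2 ^ D) ^ Suc k)) \<le> C * ((2 ^ D) ^ Suc k * (real D * ln (16 * T)))"
        by (rule mult_left_mono[OF _ C])
      with card[of k] show "real (card (N k)) \<le> C * real D * ln (16 * T) * (2 ^ D) ^ Suc k"
        by (simp only: mult_ac)
    qed
    also have "\<dots> = C * real D * ln (16 * T) * (\<Sum>k\<le>m. (2 ^ D) ^ Suc k)"
      by (rule sum_distrib_left[symmetric])
    also have "\<dots> \<le> C * real D * (2 * ln T) * (2 * (16 ^ D * T ^ D))"
    proof (rule mult_mono)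
      have "ln (16 * T) = ln 16 + ln T" using T by (simp add: ln_mult)
      also have "\<dots> \<le> 2 * ln T" using T by simp
      finally show "C * real D * ln (16 * T) \<le> C * real D * (2 * ln T)"
        using C by (intro mult_left_mono) auto
      have "(2 :: real) ^ 1 \<le> 2 ^ D" using D by (intro power_increasing) auto
      then have "(\<Sum>k\<le>m. ((2 :: real) ^ D) ^ Suc k) \<le> 2 * (2 ^ D) ^ Suc m"
        by (intro sum_power_Suc_le) simp
      also have "((2 :: real) ^ D) ^ Suc m = (2 ^ Suc m) ^ D" by (simp only: power_mult[symmetric] mult.commute)
      also have "\<dots> \<le> (16 * T) ^ D" using m(1) by (intro power_mono) auto
      finally show "(\<Sum>k\<le>m. ((2 :: real) ^ D) ^ Suc k) \<le> 2 * (16 ^ D * T ^ D)"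
        by (simp add: power_mult_distrib)
      show "0 \<le> C * real D * (2 * ln T)" using C T by simp
    qed (intro sum_nonneg; simp)
    finally show "norm (real (card (cball 0 T \<inter> shell_union N)))
        \<le> C * real D * 2 * 16 ^ D * 2 * norm (T ^ D * ln T)"
      using T by (simp add: mult_ac)
  qed
  ultimately show ?thesis unfolding has_growth_rate_def by blast
qed

text \<open>A quarter of the segment next to its outer endpoint \<open>q\<close> stays at norms comparable to that
  of \<open>q\<close>, hence in a single shell.\<close>
lemma shell_union_near_segment:
  fixes N :: "nat \<Rightarrow> (real ^ 'n::finite) set" and p q :: "real ^ 'n"
  assumes d: "CARD('n) \<ge> 2" and \<epsilon>: "0 < \<epsilon>" "\<epsilon> < 1"
    and hit: "\<And>k s B. box_with_sides s B \<Longrightarrow> B \<subseteq> unit_cube \<Longrightarrow>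
      1 / (2 ^ CARD('n)) ^ Suc k \<le> measure lebesgue B \<Longrightarrow> N k \<inter> B \<noteq> {}"
    and pq: "norm p \<le> norm q"
    and len: "dist p q = 10 * real CARD('n) ^ (CARD('n) - 1) / \<epsilon> ^ (CARD('n) - 1)"
  shows "\<exists>x\<in>shell_union N. infdist x (closed_segment p q) \<le> \<epsilon>"
proof -
  define D where "D = CARD('n)"
  define R where "R = norm q"
  define l where "l = dist p q"
  define u where "u = (p - q) /\<^sub>R l"
  have D1: "1 \<le> real D" using d by (simp add: D_def)
  have "10 * 1 \<le> 10 * real D ^ (D - 1)" using D1 by (intro mult_left_mono one_le_power) auto
  also have "\<dots> \<le> l"
    unfolding l_def len D_def[symmetric] using \<epsilon> D1
    by (simp add: le_divide_eq power_le_one mult_left_le)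
  finally have l: "10 \<le> l" by simp
  have "l \<le> norm p + norm q" unfolding l_def by (simp add: dist_norm norm_triangle_ineq4)
  with pq have lR: "l \<le> 2 * R" by (simp add: R_def)
  have "norm u = inverse l * l" using l by (simp add: u_def l_def dist_norm)
  then have u: "norm u = 1" using l by simp
  have seg: "q + t *\<^sub>R u \<in> closed_segment p q" if "0 \<le> t" "t \<le> l" for t
  proof -
    have "q + t *\<^sub>R u = (1 - t / l) *\<^sub>R q + (t / l) *\<^sub>R p"
      by (simp add: u_def algebra_simps divide_inverse)
    then show ?thesis
      using that l by (subst closed_segment_commute)
        (auto simp: closed_segment_def intro!: exI[of _ "t / l"])
  qed
  have segnorm: "norm x \<le> R" if "x \<in> closed_segment p q" for x
  proof -
    have "closed_segment p q \<subseteq> cball 0 R"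
      using pq by (intro closed_segment_subset) (auto simp: R_def)
    with that show ?thesis by auto
  qed
  \<comment> \<open>With R + 1 \<le> 2^k \<le> 2 (R + 1), the cube of side \<open>2 ^ Suc k\<close>
    contains the \<epsilon>-neighbourhood of the segment, while the threshold 2^k / 8 stays below
    the norms near its outer quarter.\<close>
  obtain k' where k': "2 ^ k' \<le> R + 1" "R + 1 < 2 ^ Suc k'"
    using power_two_bracket[of "R + 1"] by (auto simp: R_def)
  define k where "k = Suc k'"
  have k: "R + 1 \<le> 2 ^ k" "2 ^ k \<le> 2 * (R + 1)" using k' by (auto simp: k_def)
  define S :: real where "S = 2 ^ Suc k"
  have S: "0 < S" by (simp add: S_def)
  \<comment> \<open>The distance d r allowed by \<open>box_around_segment\<close> becomes exactly
    \<epsilon> after scaling by \<open>S\<close>; the length \<open>l / (4 * S)\<close> used with it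
    becomes a quarter of the segment.\<close>
  define r where "r = \<epsilon> / (real D * S)"
  have r: "0 < r" using \<epsilon> D1 S by (simp add: r_def)
  have Dr: "real D * r = \<epsilon> / S" using D1 by (simp add: r_def)
  have "0 \<le> l / (4 * S)" using l S by simp
  from box_around_segment[OF d u r this, of "q /\<^sub>R S"]
  obtain s B where B: "box_with_sides s B" "measure lebesgue B = l / (4 * S) * (2 * r) ^ (D - 1)"
    and near: "\<And>y. y \<in> B \<Longrightarrow> \<exists>t\<in>{0..l / (4 * S)}. dist y (q /\<^sub>R S + t *\<^sub>R u) \<le> \<epsilon> / S"
    unfolding D_def[symmetric] Dr by blast
  have scaled: "\<exists>z \<in> closed_segment p q. dist (S *\<^sub>R y) z \<le> \<epsilon> \<and> R - l / 4 \<le> norm z" if y: "y \<in> B" for y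
  proof -
    obtain t where t: "0 \<le> t" "t \<le> l / (4 * S)" "dist y (q /\<^sub>R S + t *\<^sub>R u) \<le> \<epsilon> / S"
      using near[OF y] by auto
    define z where "z = q + (S * t) *\<^sub>R u"
    have St: "0 \<le> S * t" "S * t \<le> l / 4" using t S by (auto simp: field_simps)
    have "z \<in> closed_segment p q" unfolding z_def using St l by (intro seg) auto
    moreover have "dist (S *\<^sub>R y) z \<le> \<epsilon>"
    proof -
      have "S *\<^sub>R y - z = S *\<^sub>R (y - (q /\<^sub>R S + t *\<^sub>R u))"
        using S by (simp add: z_def algebra_simps)
      then have "dist (S *\<^sub>R y) z = S * dist y (q /\<^sub>R S + t *\<^sub>R u)"
        using S by (simp add: dist_norm)
      also have "\<dots> \<le> S * (\<epsilon> / S)" using t(3) S by (intro mult_left_mono) auto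
      finally show ?thesis using S by simp
    qed
    moreover have "R - l / 4 \<le> norm z"
    proof -
      have "norm q - norm ((S * t) *\<^sub>R u) \<le> norm z"
        unfolding z_def using norm_diff_ineq by blast
      then show ?thesis using u St by (simp add: R_def)
    qed
    ultimately show ?thesis by blast
  qed
  have "B \<subseteq> unit_cube"
  proof
    fix y assume "y \<in> B"
    then obtain z where z: "z \<in> closed_segment p q" "dist (S *\<^sub>R y) z \<le> \<epsilon>" using scaled by blast
    have "norm (S *\<^sub>R y) \<le> norm z + dist (S *\<^sub>R y) z"
      using norm_triangle_sub[of "S *\<^sub>R y" z] by (simp add: dist_norm)
    then have "S * norm y \<le> R + 1" using segnorm[OF z(1)] z(2) \<epsilon> S by simp
    also have "\<dots> \<le> S / 2" using k(1) by (simp add: S_def)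
    finally have "norm y \<le> 1 / 2" using S by (simp add: field_simps)
    then have "- (1 / 2) \<le> y $ i" "y $ i \<le> 1 / 2" for i
      using component_le_norm_cart[of y i] by linarith+
    then show "y \<in> unit_cube" by (simp add: unit_cube_def mem_box_cart)
  qed
  \<comment> \<open>The segment length makes \<open>l * \<epsilon> ^ (D - 1)\<close> equal to
    \<open>10 * D ^ (D - 1)\<close>, so \<epsilon> cancels from the volume, which is
    \<open>10 / 4 * 2 ^ (D - 1) / S ^ D\<close>.\<close>
  moreover have "1 / (2 ^ CARD('n)) ^ Suc k \<le> measure lebesgue B"
  proof -
    have "S ^ D = S * S ^ (D - 1)" using d by (simp add: D_def power_eq_if)
    then have "measure lebesgue B = (l * \<epsilon> ^ (D - 1)) * 2 ^ (D - 1) / (4 * real D ^ (D - 1)) / S ^ D"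
      unfolding B(2) r_def by (simp add: power_mult_distrib power_divide mult_ac)
    also have "l * \<epsilon> ^ (D - 1) = 10 * real D ^ (D - 1)"
      using \<epsilon> unfolding l_def len D_def by simp
    also have "10 * real D ^ (D - 1) * 2 ^ (D - 1) / (4 * real D ^ (D - 1)) = 10 / 4 * 2 ^ (D - 1)"
      using D1 by simp
    finally have "measure lebesgue B = 10 / 4 * 2 ^ (D - 1) / S ^ D" .
    moreover have "(1::real) \<le> 2 ^ (D - 1)" by simp
    then have "1 \<le> 10 / 4 * (2::real) ^ (D - 1)" by linarith
    then have "1 / S ^ D \<le> 10 / 4 * 2 ^ (D - 1) / S ^ D" using S by (intro divide_right_mono) auto
    moreover have "S ^ D = (2 ^ CARD('n)) ^ Suc k"
      by (simp only: S_def D_def power_mult[symmetric] mult.commute)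
    ultimately show ?thesis by simp
  qed
  ultimately obtain y where y: "y \<in> N k" "y \<in> B" using hit[OF B(1), of k] by blast
  define w where "w = S *\<^sub>R y"
  obtain z where z: "z \<in> closed_segment p q" "dist w z \<le> \<epsilon>" "R - l / 4 \<le> norm z"
    using scaled[OF y(2)] unfolding w_def by blast
  have "norm z \<le> norm w + dist w z"
    using norm_triangle_sub[of z w] by (simp add: dist_norm norm_minus_commute)
  \<comment> \<open>Since l \<le> 2 R, norm z \<ge> R - l/4 \<ge> R/2. The inequality 2 (R + 1)
    \<le> 8 (R/2 - 1) amounts to R \<ge> 5, which follows from l \<ge> 10: a second use of the
    constant 10.\<close>
  then have "R / 2 - 1 \<le> norm w" using z \<epsilon> lR by linarith
  moreover have "5 \<le> R" using l lR by linarith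
  ultimately have "2 * (R + 1) \<le> 8 * norm w" by argo
  with k(2) have "2 ^ k \<le> 8 * norm w" by (rule order_trans)
  then have "w \<in> shell_union N"
    unfolding shell_union_def w_def S_def using y(1) by blast
  moreover have "infdist w (closed_segment p q) \<le> \<epsilon>"
    using infdist_le[OF z(1), of w] z(2) by linarith
  ultimately show ?thesis by blast
qed

text \<open>Scaling by \<open>2 ^ Suc k\<close> multiplies volumes by V =
  \<open>(2 ^ CARD('n)) ^ Suc k\<close>, so the scaled \<open>N k\<close> meets every box of volume
  at least 1 in the scaled cube, with at most C V ln V points.\<close>

lemma optical_forest_shell_union:
  fixes N :: "nat \<Rightarrow> (real ^ 'n::finite) set"
  assumes d: "CARD('n) \<ge> 2" and C: "0 \<le> C"
    and fin: "\<And>k. finite (N k)"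
    and card: "\<And>k. real (card (N k)) \<le> C * ((2 ^ CARD('n)) ^ Suc k * ln ((2 ^ CARD('n)) ^ Suc k))"
    and hit: "\<And>k s B. box_with_sides s B \<Longrightarrow> B \<subseteq> unit_cube \<Longrightarrow>
      1 / (2 ^ CARD('n)) ^ Suc k \<le> measure lebesgue B \<Longrightarrow> N k \<inter> B \<noteq> {}"
  shows "optical_forest (shell_union N) (\<lambda>T. T ^ CARD('n) * ln T)"
  unfolding optical_forest_def
proof (intro conjI exI[of _ "10 * real CARD('n) ^ (CARD('n) - 1)"] ballI allI impI)
  show "(\<lambda>T. T ^ CARD('n)) \<in> O[at_top](\<lambda>T::real. T ^ CARD('n) * ln T)"
  proof (rule bigoI[where c = 1], rule eventually_at_top_linorderI[of "exp (1::real)"])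
    fix T :: real assume T: "exp 1 \<le> T"
    then have "0 < T" using exp_gt_zero[of "1::real"] by linarith
    with T have "1 \<le> ln T" by (simp add: ln_ge_iff)
    with \<open>0 < T\<close> show "norm (T ^ CARD('n)) \<le> 1 * norm (T ^ CARD('n) * ln T)"
      by (simp add: abs_mult)
  qed
  show "has_growth_rate (shell_union N) (\<lambda>T. T ^ CARD('n) * ln T)"
    using d by (intro shell_union_growth[OF fin _ C card]) auto
  show "0 < 10 * real CARD('n) ^ (CARD('n) - 1)" by simp
next
  fix \<epsilon> :: real and p q :: "real ^ 'n"
  assume \<epsilon>: "\<epsilon> \<in> {0<..<1}"
    and len: "dist p q = 10 * real CARD('n) ^ (CARD('n) - 1) / \<epsilon> ^ (CARD('n) - 1)"
  show "\<exists>x\<in>shell_union N. infdist x (closed_segment p q) \<le> \<epsilon>"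
  \<comment> \<open>The endpoints may be exchanged, so that the second one is the outer one.\<close>
  proof (cases "norm p \<le> norm q")
    case True
    with \<epsilon> len show ?thesis by (intro shell_union_near_segment[OF d _ _ hit]) auto
  next
    case False
    with \<epsilon> len show ?thesis
      by (subst closed_segment_commute, intro shell_union_near_segment[OF d _ _ hit])
        (auto simp: dist_commute)
  qed
qed

theorem theorem1p0p2:
  assumes "CARD('n::finite) \<ge> 2"
  shows "(\<exists>C>0. \<exists>\<epsilon>0\<in>{0<..<1::real}. \<forall>\<epsilon>>0. \<exists>N :: (real ^ 'n) set.
            eps_net \<epsilon> unit_cube unit_cube_boxes N \<and>
            (\<epsilon> \<le> \<epsilon>0 \<longrightarrow> finite N \<and> real (card N) \<le> C * ((1 / \<epsilon>) * ln (1 / \<epsilon>))))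
       \<and> (\<exists>F :: (real ^ 'n) set. optical_forest F (\<lambda>T. T ^ CARD('n) * ln T))"
proof -
  obtain C where C: "0 < C" and nets: "\<And>\<epsilon>. 0 < \<epsilon> \<Longrightarrow> \<epsilon> \<le> 1 / 2 \<Longrightarrow> \<exists>N :: (real ^ 'n) set.
    N \<subseteq> unit_cube \<and> finite N \<and> real (card N) \<le> C * ((1 / \<epsilon>) * ln (1 / \<epsilon>)) \<and>
    (\<forall>s B. box_with_sides s B \<and> B \<subseteq> unit_cube \<and> \<epsilon> \<le> measure lebesgue B \<longrightarrow> N \<inter> B \<noteq> {})"
    using unit_cube_hitting_set[where 'n = 'n] by blast
  have "\<exists>N :: (real ^ 'n) set. eps_net \<epsilon> unit_cube unit_cube_boxes N \<and>
      (\<epsilon> \<le> 1 / 2 \<longrightarrow> finite N \<and> real (card N) \<le> C * ((1 / \<epsilon>) * ln (1 / \<epsilon>)))" if "0 < \<epsilon>" for \<epsilon>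
  proof (cases "\<epsilon> \<le> 1 / 2")
    case True
    obtain N :: "(real ^ 'n) set" where N: "N \<subseteq> unit_cube" "finite N"
      "real (card N) \<le> C * ((1 / \<epsilon>) * ln (1 / \<epsilon>))"
      "\<And>s B. box_with_sides s B \<Longrightarrow> B \<subseteq> unit_cube \<Longrightarrow> \<epsilon> \<le> measure lebesgue B \<Longrightarrow> N \<inter> B \<noteq> {}"
      using nets[OF \<open>0 < \<epsilon>\<close> True] by blast
    then have "eps_net \<epsilon> unit_cube unit_cube_boxes N"
      unfolding eps_net_def unit_cube_boxes_def by blast
    with N show ?thesis by blast
  next
    case False
    \<comment> \<open>Above \<epsilon>0 = 1/2 no bound on the size is demanded, and a range of
      positive measure is a nonempty subset of the cube, so the whole cube is a net.\<close>
    have "eps_net \<epsilon> unit_cube unit_cube_boxes (unit_cube :: (real ^ 'n) set)"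
      using that unfolding eps_net_def unit_cube_boxes_def by (auto simp: inf.absorb2)
    with False show ?thesis by blast
  qed
  then have "\<exists>C>0. \<exists>\<epsilon>0\<in>{0<..<1::real}. \<forall>\<epsilon>>0. \<exists>N :: (real ^ 'n) set.
            eps_net \<epsilon> unit_cube unit_cube_boxes N \<and>
            (\<epsilon> \<le> \<epsilon>0 \<longrightarrow> finite N \<and> real (card N) \<le> C * ((1 / \<epsilon>) * ln (1 / \<epsilon>)))"
    using C by (intro exI[of _ C] conjI bexI[of _ "1 / 2"]) auto
  moreover have "\<exists>F :: (real ^ 'n) set. optical_forest F (\<lambda>T. T ^ CARD('n) * ln T)"
  proof -
    \<comment> \<open>All volumes required by the shells lie in the range where \<open>nets\<close>
      applies.\<close>
    have "1 / ((2 :: real) ^ CARD('n)) ^ Suc k \<le> 1 / 2" for k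
    proof -
      have "(2 :: real) ^ 1 \<le> 2 ^ (CARD('n) * Suc k)" by (intro power_increasing) (auto simp: Suc_le_eq)
      then show ?thesis by (simp only: power_mult) (simp add: field_simps)
    qed
    then have "\<exists>N :: (real ^ 'n) set. finite N \<and>
      real (card N) \<le> C * ((2 ^ CARD('n)) ^ Suc k * ln ((2 ^ CARD('n)) ^ Suc k)) \<and>
      (\<forall>s B. box_with_sides s B \<and> B \<subseteq> unit_cube \<and>
        1 / (2 ^ CARD('n)) ^ Suc k \<le> measure lebesgue B \<longrightarrow> N \<inter> B \<noteq> {})" for k
      using nets[of "1 / (2 ^ CARD('n)) ^ Suc k"] by (simp only: div_by_1 divide_divide_eq_right mult_1_left) force
    then obtain N :: "nat \<Rightarrow> (real ^ 'n) set" where "\<And>k. finite (N k)"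
      "\<And>k. real (card (N k)) \<le> C * ((2 ^ CARD('n)) ^ Suc k * ln ((2 ^ CARD('n)) ^ Suc k))"
      "\<And>k s B. box_with_sides s B \<Longrightarrow> B \<subseteq> unit_cube \<Longrightarrow>
        1 / (2 ^ CARD('n)) ^ Suc k \<le> measure lebesgue B \<Longrightarrow> N k \<inter> B \<noteq> {}"
      by metis
    with C show ?thesis
      by (intro exI[of _ "shell_union N"] optical_forest_shell_union[OF assms, of C]) auto
  qed
  ultimately show ?thesis by blast
qed

end
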